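(* Let $\delta\in\mathbb{C}$, let $\mathcal{A}$ be a commutative associative algebra over $\mathbb{C}$ and let $\varphi$ be a $\delta$-derivation of $\mathcal{A}$. For fixed elements $q,h\in\mathcal{A}$, define operations on $\mathcal{A}$ by $$x\cdot_q y=qxy,\qquad x\times_h y=x\varphi(y)+hxy.$$ Then $(\mathcal{A},\cdot_q,\times_h)$ is a $\delta$-Novikov--Poisson algebra.
   Context: A $\delta$-derivation of an algebra $\mathcal{A}$ is a linear map $\varphi:\mathcal{A}\to\mathcal{A}$ with $\varphi(xy)=\delta(\varphi(x)y+x\varphi(y))$ for all $x,y$. A (left) $\delta$-Novikov algebra is an algebra $(N,\circ)$ satisfying $\delta(x\circ y)\circ z-x\circ(y\circ z)=\delta(y\circ x)\circ z-y\circ(x\circ z)$ and $(x\circ y)\circ z=(x\circ z)\circ y$. A $\delta$-Novikov--Poisson algebra is a vector space $N$ with two bilinear operations $\cdot$ (also written by juxtaposition) and $\circ$ such that $(N,\cdot)$ is a commutative associative algebra, $(N,\circ)$ is a $\delta$-Novikov algebra, and for all $x,y,z\in N$: $(xy)\circ z=x(y\circ z)$ and $\delta(x\circ y)z-x\circ(yz)=\delta(y\circ x)z-y\circ(xz)$. *)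

theory Defs
  imports Complex_Main
begin

(* The underlying vector space is the whole type 'a, with an explicit scalar action.  The product
   is an arbitrary bilinear map: it is not assumed to be associative or to have a unit. *)
locale bilinear_algebra = vector_space scale
  for scale :: "'k::field \<Rightarrow> 'a::ab_group_add \<Rightarrow> 'a" +
  fixes mult :: "'a \<Rightarrow> 'a \<Rightarrow> 'a"
  assumes linear_left: "Vector_Spaces.linear scale scale (\<lambda>x. mult x y)"
    and linear_right: "Vector_Spaces.linear scale scale (\<lambda>y. mult x y)"

locale comm_assoc_algebra = bilinear_algebra scale mult
  for scale :: "'k::field \<Rightarrow> 'a::ab_group_add \<Rightarrow> 'a" and mult :: "'a \<Rightarrow> 'a \<Rightarrow> 'a" +
  assumes assoc: "mult (mult x y) z = mult x (mult y z)"
    and commute: "mult x y = mult y x"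

definition delta_derivation ::
    "('k::field \<Rightarrow> 'a::ab_group_add \<Rightarrow> 'a) \<Rightarrow> ('a \<Rightarrow> 'a \<Rightarrow> 'a) \<Rightarrow> 'k \<Rightarrow> ('a \<Rightarrow> 'a) \<Rightarrow> bool" where
  "delta_derivation scale mult \<delta> \<phi> \<longleftrightarrow>
     Vector_Spaces.linear scale scale \<phi> \<and>
     (\<forall>x y. \<phi> (mult x y) = scale \<delta> (mult (\<phi> x) y + mult x (\<phi> y)))"

locale delta_novikov_algebra = bilinear_algebra scale circ
  for scale :: "'k::field \<Rightarrow> 'a::ab_group_add \<Rightarrow> 'a"
    and circ :: "'a \<Rightarrow> 'a \<Rightarrow> 'a" (infixl "\<circ>\<^sub>N" 70) +
  fixes \<delta> :: 'k
  assumes delta_left_symmetric: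
      "scale \<delta> ((x \<circ>\<^sub>N y) \<circ>\<^sub>N z) - x \<circ>\<^sub>N (y \<circ>\<^sub>N z) = scale \<delta> ((y \<circ>\<^sub>N x) \<circ>\<^sub>N z) - y \<circ>\<^sub>N (x \<circ>\<^sub>N z)"
    and right_commutative: "(x \<circ>\<^sub>N y) \<circ>\<^sub>N z = (x \<circ>\<^sub>N z) \<circ>\<^sub>N y"

locale delta_novikov_poisson_algebra =
  dot: comm_assoc_algebra scale dot + circ: delta_novikov_algebra scale circ \<delta>
  for scale :: "'k::field \<Rightarrow> 'a::ab_group_add \<Rightarrow> 'a"
    and dot :: "'a \<Rightarrow> 'a \<Rightarrow> 'a" (infixl "\<cdot>\<^sub>N" 70)
    and circ :: "'a \<Rightarrow> 'a \<Rightarrow> 'a" (infixl "\<circ>\<^sub>N" 70)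
    and \<delta> :: 'k +
  assumes dot_circ: "(x \<cdot>\<^sub>N y) \<circ>\<^sub>N z = x \<cdot>\<^sub>N (y \<circ>\<^sub>N z)"
    and delta_compat:
      "scale \<delta> ((x \<circ>\<^sub>N y) \<cdot>\<^sub>N z) - x \<circ>\<^sub>N (y \<cdot>\<^sub>N z) = scale \<delta> ((y \<circ>\<^sub>N x) \<cdot>\<^sub>N z) - y \<circ>\<^sub>N (x \<cdot>\<^sub>N z)"

end

theory Submission
  imports Defs
begin

text \<open>
  Write \<open>L y = \<phi> y + h y\<close>, so that the new product is \<open>x \<times> y = x (L y)\<close> in the commutative
  associative algebra. Products that only multiply by elements, such as \<open>(x \<times> y) \<times> z = x (L y) (L z)\<close>
  or \<open>(q x y) \<times> z = q x y (L z)\<close>, make the right commutativity and the compatibility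
  \<open>(x \<cdot> y) \<times> z = x \<cdot> (y \<times> z)\<close> immediate.

  The two remaining axioms are instances of one symmetry: for every \<open>w\<close>, the expression
  \<open>\<delta> (x \<times> y) w - x \<times> (y w)\<close> is symmetric in \<open>x\<close> and \<open>y\<close>. Indeed, expanding \<open>\<phi> (y w)\<close> by the
  \<open>\<delta>\<close>-derivation rule produces a term \<open>\<delta> x (\<phi> y) w\<close>, the only one not symmetric in \<open>x\<close> and
  \<open>y\<close>, and it cancels against the same term of \<open>\<delta> (x \<times> y) w\<close>. With \<open>w = L z\<close> this is
  \<open>\<delta>\<close>-left-symmetry, since \<open>y \<times> z = y w\<close> and \<open>(x \<times> y) \<times> z = (x \<times> y) w\<close>; with \<open>w = q z\<close> it is the
  \<open>\<delta>\<close>-compatibility of the two products.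
\<close>

context comm_assoc_algebra
begin

lemma left_commute: "mult x (mult y z) = mult y (mult x z)"
  by (metis assoc commute)

lemmas mult_ac = assoc commute left_commute

lemma linear_endomorphism_iff:
  "Vector_Spaces.linear scale scale f \<longleftrightarrow>
    (\<forall>x y. f (x + y) = f x + f y) \<and> (\<forall>c x. f (scale c x) = scale c (f x))"
  by (simp add: linear_iff_module_hom module_hom_iff module_axioms)

lemmas linear_endomorphism_add = linear_endomorphism_iff[THEN iffD1, THEN conjunct1, rule_format]
lemmas linear_endomorphism_scale = linear_endomorphism_iff[THEN iffD1, THEN conjunct2, rule_format]

lemma mult_add_left: "mult (x + y) z = mult x z + mult y z"
  using linear_left[of z] by (rule linear_endomorphism_add)

lemma mult_add_right: "mult x (y + z) = mult x y + mult x z"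
  using linear_right[of x] by (rule linear_endomorphism_add)

lemma mult_scale_left: "mult (scale c x) y = scale c (mult x y)"
  using linear_left[of y] by (rule linear_endomorphism_scale)

lemma mult_scale_right: "mult x (scale c y) = scale c (mult x y)"
  using linear_right[of x] by (rule linear_endomorphism_scale)

lemma comm_assoc_algebra_scaled_mult:
  "comm_assoc_algebra scale (\<lambda>x y. mult (mult q x) y)"
proof (intro comm_assoc_algebra.intro bilinear_algebra.intro bilinear_algebra_axioms.intro
    comm_assoc_algebra_axioms.intro vector_space_axioms)
  show "Vector_Spaces.linear scale scale (\<lambda>x. mult (mult q x) y)" for y
    by (simp add: linear_endomorphism_iff mult_add_left mult_add_right mult_scale_left
        mult_scale_right)
  show "Vector_Spaces.linear scale scale (\<lambda>y. mult (mult q x) y)" for x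
    by (rule linear_right)
qed (simp_all add: mult_ac)

lemma bilinear_algebra_twisted_mult:
  assumes "Vector_Spaces.linear scale scale \<phi>"
  shows "bilinear_algebra scale (\<lambda>x y. mult x (\<phi> y) + mult (mult h x) y)"
proof (intro bilinear_algebra.intro bilinear_algebra_axioms.intro vector_space_axioms)
  note expand = mult_add_left mult_add_right mult_scale_left mult_scale_right scale_right_distrib
    linear_endomorphism_add[OF assms] linear_endomorphism_scale[OF assms]
  show "Vector_Spaces.linear scale scale (\<lambda>x. mult x (\<phi> y) + mult (mult h x) y)" for y
    by (simp add: linear_endomorphism_iff expand add_ac)
  show "Vector_Spaces.linear scale scale (\<lambda>y. mult x (\<phi> y) + mult (mult h x) y)" for x
    by (simp add: linear_endomorphism_iff expand add_ac)
qed

text \<open>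
  The right-hand side visibly depends only on the product of \<open>x\<close> and \<open>y\<close>: the \<open>\<delta>\<close>-derivation
  rule for \<open>\<phi> (y w)\<close> yields exactly the term \<open>\<delta> x (\<phi> y) w\<close> that has to cancel. The factor \<open>w\<close>
  is arbitrary so that the identity serves both for \<open>\<delta>\<close>-left-symmetry and for
  \<open>\<delta>\<close>-compatibility.
\<close>

lemma twisted_mult_defect:
  fixes h :: 'a
  assumes "delta_derivation scale mult \<delta> \<phi>"
  defines "circ \<equiv> \<lambda>x y. mult x (\<phi> y) + mult (mult h x) y"
  shows "scale \<delta> (mult (circ x y) w) - circ x (mult y w) =
    scale \<delta> (mult h (mult (mult x y) w)) - scale \<delta> (mult (mult x y) (\<phi> w))
      - mult h (mult (mult x y) w)"
proof -
  have leibniz: "\<phi> (mult y w) = scale \<delta> (mult (\<phi> y) w + mult y (\<phi> w))"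
    using assms(1) by (simp add: delta_derivation_def)
  show ?thesis
    unfolding circ_def leibniz
    by (simp add: mult_add_left mult_add_right mult_scale_right scale_right_distrib assoc)
qed

lemma twisted_mult_defect_symmetric:
  fixes h :: 'a
  assumes "delta_derivation scale mult \<delta> \<phi>"
  defines "circ \<equiv> \<lambda>x y. mult x (\<phi> y) + mult (mult h x) y"
  shows "scale \<delta> (mult (circ x y) w) - circ x (mult y w) =
    scale \<delta> (mult (circ y x) w) - circ y (mult x w)"
  unfolding circ_def twisted_mult_defect[OF assms(1)] commute[of x y] by (rule refl)

end

theorem corollary24:
  fixes scale :: "complex \<Rightarrow> 'a::ab_group_add \<Rightarrow> 'a"
    and mult :: "'a \<Rightarrow> 'a \<Rightarrow> 'a" (infixl "\<bullet>" 70)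
    and \<delta> :: complex
    and \<phi> :: "'a \<Rightarrow> 'a"
    and q h :: 'a
  assumes "comm_assoc_algebra scale mult"
    and "delta_derivation scale mult \<delta> \<phi>"
  shows "delta_novikov_poisson_algebra scale
           (\<lambda>x y. q \<bullet> x \<bullet> y)
           (\<lambda>x y. x \<bullet> \<phi> y + h \<bullet> x \<bullet> y)
           \<delta>"
proof -
  interpret A: comm_assoc_algebra scale mult by (rule assms(1))
  define circ where "circ = (\<lambda>x y. x \<bullet> \<phi> y + h \<bullet> x \<bullet> y)"
  define L where "L = (\<lambda>y. \<phi> y + h \<bullet> y)"
  have circ_L: "circ x y = x \<bullet> L y" for x y
    by (simp add: circ_def L_def A.mult_add_right A.mult_ac)
  have defect: "scale \<delta> (circ x y \<bullet> w) - circ x (y \<bullet> w) =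
      scale \<delta> (circ y x \<bullet> w) - circ y (x \<bullet> w)" for x y w
    unfolding circ_def by (rule A.twisted_mult_defect_symmetric[OF assms(2)])
  interpret dot: comm_assoc_algebra scale "\<lambda>x y. q \<bullet> x \<bullet> y"
    by (rule A.comm_assoc_algebra_scaled_mult)
  interpret circ: bilinear_algebra scale circ
    unfolding circ_def
    using assms(2) by (intro A.bilinear_algebra_twisted_mult) (simp add: delta_derivation_def)
  have "delta_novikov_poisson_algebra scale (\<lambda>x y. q \<bullet> x \<bullet> y) circ \<delta>"
  proof unfold_locales
    fix x y z
    show "scale \<delta> (circ (circ x y) z) - circ x (circ y z) =
        scale \<delta> (circ (circ y x) z) - circ y (circ x z)"
      using defect[of x y "L z"] by (simp only: circ_L)
    show "circ (circ x y) z = circ (circ x z) y"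
      by (simp add: circ_L A.mult_ac)
    show "circ (q \<bullet> x \<bullet> y) z = q \<bullet> x \<bullet> circ y z"
      by (simp add: circ_L A.assoc)
    have dot_w: "q \<bullet> u \<bullet> v = u \<bullet> (q \<bullet> v)" for u v
      by (simp add: A.mult_ac)
    show "scale \<delta> (q \<bullet> circ x y \<bullet> z) - circ x (q \<bullet> y \<bullet> z) =
        scale \<delta> (q \<bullet> circ y x \<bullet> z) - circ y (q \<bullet> x \<bullet> z)"
      unfolding dot_w by (rule defect)
  qed
  then show ?thesis
    by (simp only: circ_def)
qed

end
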